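(* Let $n,k\ge 1$, let $C_0\in\mathbb{R}^{n\times n}$ be an $M$-matrix and let $C_1,\dots,C_k\in\mathbb{R}^{n\times n}$. If ${\bf C}=(C_0,C_1,\dots,C_k)$ is connected, then $\mathrm{SOL}({\bf C},{\bf d},q)=\{(C_0^{-1}q,0,\dots,0)\}$ for all $q\in\mathbb{R}^n_{++}$ and all ${\bf d}\in(\mathbb{R}^n_{++})^{k-1}$.
   Context: Notation: $\mathbb{R}^n_{+}$ (resp. $\mathbb{R}^n_{++}$) is the set of vectors in $\mathbb{R}^n$ with all entries non-negative (resp. positive); $x\wedge y$ is the componentwise minimum of $x,y\in\mathbb{R}^n$. A real square matrix is a $Z$-matrix if all its off-diagonal entries are non-positive. A matrix $A\in\mathbb{R}^{n\times n}$ is an $M$-matrix if it is an invertible $Z$-matrix with $A^{-1}(\mathbb{R}^n_+)\subseteq\mathbb{R}^n_+$. Extended horizontal linear complementarity problem: given ${\bf C}=(C_0,\dots,C_k)$ with $C_i\in\mathbb{R}^{n\times n}$, $q\in\mathbb{R}^n$ and ${\bf d}=(d_1,\dots,d_{k-1})\in(\mathbb{R}^n_{++})^{k-1}$ (empty if $k=1$), $\mathrm{EHLCP}({\bf C},{\bf d},q)$ asks for $(x_0,x_1,\dots,x_k)\in(\mathbb{R}^n)^{k+1}$ with $$C_0x_0=q+\sum_{i=1}^k C_ix_i,\qquad x_0\wedge x_1=0,\qquad (d_j-x_j)\wedge x_{j+1}=0\ \ (1\le j\le k-1).$$ $\mathrm{SOL}({\bf C},{\bf d},q)\subseteq(\mathbb{R}^n)^{k+1}$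 denotes the set of all its solutions. The tuple ${\bf C}$ is called connected if $\mathrm{SOL}({\bf C},{\bf d},q)$ is a connected set for all $q\in\mathbb{R}^n$ and all ${\bf d}\in(\mathbb{R}^n_{++})^{k-1}$ (the empty set counts as connected). *)

theory Defs
  imports "HOL-Analysis.Analysis"
begin

definition nonneg_vecs :: "(real ^ 'n) set" where
  "nonneg_vecs = {x. \<forall>i. 0 \<le> x $ i}"

(* Strict positivity is required in every component. The library order x < y on vectors only
   means x \<le> y and x \<noteq> y, so it is not used here. *)
definition pos_vecs :: "(real ^ 'n) set" where
  "pos_vecs = {x. \<forall>i. 0 < x $ i}"

definition Z_matrix :: "real ^ 'n ^ 'n \<Rightarrow> bool" where
  "Z_matrix A \<longleftrightarrow> (\<forall>i j. i \<noteq> j \<longrightarrow> A $ i $ j \<le> 0)"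

definition M_matrix :: "real ^ 'n ^ 'n \<Rightarrow> bool" where
  "M_matrix A \<longleftrightarrow> invertible A \<and> Z_matrix A \<and> (*v) (matrix_inv A) ` nonneg_vecs \<subseteq> nonneg_vecs"

(* A tuple (x_0, ..., x_k) of vectors is an element x of the set of functions {..k} \<rightarrow>\<^sub>E UNIV,
   that is, a function on nat whose values outside {..k} are fixed. With the product topology
   on nat \<Rightarrow> real ^ 'n this set is homeomorphic to the (k+1)-fold power of real ^ 'n.
   Only C 0, ..., C k and d 1, ..., d (k - 1) are used.
   On real ^ 'n, inf is the componentwise minimum. *)
definition SOL ::
  "nat \<Rightarrow> (nat \<Rightarrow> real ^ 'n ^ 'n) \<Rightarrow> (nat \<Rightarrow> real ^ 'n) \<Rightarrow> real ^ 'n \<Rightarrow> (nat \<Rightarrow> real ^ 'n) set" where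
  "SOL k C d q = {x \<in> {..k} \<rightarrow>\<^sub>E UNIV.
     C 0 *v x 0 = q + (\<Sum>i = 1..k. C i *v x i) \<and>
     inf (x 0) (x 1) = 0 \<and>
     (\<forall>j \<in> {1..<k}. inf (d j - x j) (x (j + 1)) = 0)}"

definition connected_tuple :: "nat \<Rightarrow> (nat \<Rightarrow> real ^ 'n ^ 'n) \<Rightarrow> bool" where
  "connected_tuple k C \<longleftrightarrow>
     (\<forall>q d. (\<forall>j \<in> {1..<k}. d j \<in> pos_vecs) \<longrightarrow> connected (SOL k C d q))"

end

theory Submission
  imports Defs
begin

text \<open>
  For positive \<open>q\<close> the vector \<open>C\<^sub>0\<^sup>-\<^sup>1 q\<close> is positive. Complementarity propagates positivity of
  \<open>x\<^sub>0\<close> along the chain: \<open>x\<^sub>0 > 0\<close> forces \<open>x\<^sub>1 = 0\<close>, then \<open>d\<^sub>1 - x\<^sub>1 > 0\<close> forces \<open>x\<^sub>2 = 0\<close>, and so on.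
  Hence the claimed tuple is the only solution in the open set \<open>x\<^sub>0 > 0\<close>; it is an isolated point
  of the connected solution set, which is therefore a singleton.
\<close>

lemma inf_eq_0_pos_iff:
  fixes x y :: "real ^ 'n"
  assumes "x \<in> pos_vecs"
  shows "inf x y = 0 \<longleftrightarrow> y = 0"
proof -
  have "min (x $ i) (y $ i) = 0 \<longleftrightarrow> y $ i = 0" for i
  proof -
    have "0 < x $ i"
      using assms by (simp add: pos_vecs_def)
    then show ?thesis
      by (auto simp: min_def)
  qed
  then show ?thesis
    by (simp add: vec_eq_iff inf_vec_def inf_min)
qed

lemma open_pos_vecs: "open (pos_vecs :: (real ^ 'n) set)"
proof -
  have "pos_vecs = (\<Inter>i. {x :: real ^ 'n. 0 < x $ i})"
    by (auto simp: pos_vecs_def)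
  moreover have "open {x :: real ^ 'n. 0 < x $ i}" for i
    by (intro open_Collect_less continuous_intros)
  ultimately show ?thesis
    using open_INT[of UNIV "\<lambda>i. {x :: real ^ 'n. 0 < x $ i}"] by simp
qed

lemma M_matrix_mult_inv:
  assumes "M_matrix A"
  shows "A *v (matrix_inv A *v q) = q" "matrix_inv A *v (A *v q) = q"
proof -
  have "A ** matrix_inv A = mat 1 \<and> matrix_inv A ** A = mat 1"
    using assms someI_ex[of "\<lambda>B. A ** B = mat 1 \<and> B ** A = mat 1"]
    by (simp add: M_matrix_def invertible_def matrix_inv_def)
  then show "A *v (matrix_inv A *v q) = q" "matrix_inv A *v (A *v q) = q"
    by (simp_all add: matrix_vector_mul_assoc)
qed

text \<open>Nonnegativity is part of the M-matrix property; the point is strictness. If entry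
  \<open>i\<close> of \<open>p\<close> were zero, the diagonal term of row \<open>i\<close> of
  \<open>A *v p\<close> would vanish and the off-diagonal ones are nonpositive, contradicting
  \<open>q $ i > 0\<close>.\<close>

lemma M_matrix_inv_pos:
  fixes A :: "real ^ 'n ^ 'n"
  assumes M: "M_matrix A" and q: "q \<in> pos_vecs"
  shows "matrix_inv A *v q \<in> pos_vecs"
proof -
  define p where "p = matrix_inv A *v q"
  have "q \<in> nonneg_vecs"
    using q by (auto simp: pos_vecs_def nonneg_vecs_def less_imp_le)
  then have "p \<in> nonneg_vecs"
    using M by (auto simp: M_matrix_def p_def)
  then have nonneg: "0 \<le> p $ j" for j
    by (simp add: nonneg_vecs_def)
  have "p $ i \<noteq> 0" for i
  proof
    assume "p $ i = 0"
    have "A $ i $ j * p $ j \<le> 0" for j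
      using M nonneg[of j] \<open>p $ i = 0\<close>
      by (cases "i = j") (auto simp: M_matrix_def Z_matrix_def mult_nonpos_nonneg)
    then have "(A *v p) $ i \<le> 0"
      by (simp add: matrix_vector_mult_def sum_nonpos)
    moreover have "0 < (A *v p) $ i"
      using q M_matrix_mult_inv(1)[OF M, of q] by (simp add: p_def pos_vecs_def)
    ultimately show False
      by simp
  qed
  with nonneg have "p \<in> pos_vecs"
    by (simp add: pos_vecs_def order_less_le)
  then show ?thesis
    by (simp add: p_def)
qed

text \<open>Stated as an equivalence because the connectedness argument needs both directions: the
  right-hand tuple is a solution, and no other solution lies in the open region.\<close>

lemma SOL_pos_iff:
  fixes C :: "nat \<Rightarrow> real ^ 'n ^ 'n"
  assumes k: "1 \<le> k" and M: "M_matrix (C 0)"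
    and q: "q \<in> pos_vecs" and d: "\<forall>j \<in> {1..<k}. d j \<in> pos_vecs"
  shows "x \<in> SOL k C d q \<and> x 0 \<in> pos_vecs \<longleftrightarrow>
    x = (\<lambda>i \<in> {..k}. if i = 0 then matrix_inv (C 0) *v q else 0)"
    (is "_ \<longleftrightarrow> x = ?s")
proof
  assume "x \<in> SOL k C d q \<and> x 0 \<in> pos_vecs"
  then have ext: "x \<in> {..k} \<rightarrow>\<^sub>E UNIV"
    and eq: "C 0 *v x 0 = q + (\<Sum>i = 1..k. C i *v x i)"
    and first: "inf (x 0) (x 1) = 0"
    and chain: "\<And>j. j \<in> {1..<k} \<Longrightarrow> inf (d j - x j) (x (j + 1)) = 0"
    and pos: "x 0 \<in> pos_vecs"
    by (auto simp: SOL_def)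
  \<comment> \<open>The bound \<open>i \<le> k\<close> stays inside the induction formula, since the
    complementarity conditions stop at \<open>x k\<close>.\<close>
  have "i \<le> k \<longrightarrow> x i = 0" if "1 \<le> i" for i
    using that
  proof (induction i rule: dec_induct)
    case base
    show ?case
      using first pos by (simp add: inf_eq_0_pos_iff)
  next
    case (step i)
    show ?case
    proof
      assume "Suc i \<le> k"
      then have "i \<in> {1..<k}" "x i = 0"
        using step by auto
      \<comment> \<open>With \<open>x i = 0\<close>, the slack \<open>d i - x i\<close> is just the
        positive vector \<open>d i\<close>.\<close>
      then show "x (Suc i) = 0"
        using chain[of i] d inf_eq_0_pos_iff[of "d i"] by auto
    qed
  qed
  then have zero: "x i = 0" if "1 \<le> i" "i \<le> k" for i
    using that by blast
  then have "C 0 *v x 0 = q"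
    using eq by simp
  then have "x 0 = matrix_inv (C 0) *v q"
    using M_matrix_mult_inv(2)[OF M, of "x 0"] by simp
  then show "x = ?s"
    \<comment> \<open>Beyond index \<open>k\<close> both functions take the value
      \<open>undefined\<close>.\<close>
    using ext zero by (auto simp: fun_eq_iff PiE_def extensional_def)
next
  assume x: "x = ?s"
  have "x 0 \<in> pos_vecs"
    using M_matrix_inv_pos[OF M q] by (simp add: x)
  moreover have "x \<in> SOL k C d q"
    using k d M_matrix_mult_inv(1)[OF M, of q] M_matrix_inv_pos[OF M q]
    by (auto simp: SOL_def x inf_eq_0_pos_iff)
  ultimately show "x \<in> SOL k C d q \<and> x 0 \<in> pos_vecs"
    by blast
qed

theorem theorem5p3:
  fixes k :: nat and C :: "nat \<Rightarrow> real ^ 'n ^ 'n" and d :: "nat \<Rightarrow> real ^ 'n" and q :: "real ^ 'n"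
  assumes "1 \<le> k"
    and "M_matrix (C 0)"
    and "connected_tuple k C"
    and "q \<in> pos_vecs"
    and "\<forall>j \<in> {1..<k}. d j \<in> pos_vecs"
  shows "SOL k C d q = {\<lambda>i \<in> {..k}. if i = 0 then matrix_inv (C 0) *v q else 0}"
    (is "?S = {?s}")
proof -
  let ?U = "(\<lambda>x :: nat \<Rightarrow> real ^ 'n. x 0) -` pos_vecs"
  have iff: "x \<in> ?S \<and> x 0 \<in> pos_vecs \<longleftrightarrow> x = ?s" for x
    by (rule SOL_pos_iff) (use assms in auto)
  have "connected ?S"
    using assms by (auto simp: connected_tuple_def)
  moreover have "open ?U"
    by (intro open_vimage open_pos_vecs continuous_on_product_coordinates)
  \<comment> \<open>Points are closed in the product topology.\<close>
  moreover have "open (- {?s})"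
    by auto
  moreover have "?U \<inter> - {?s} \<inter> ?S = {}" "?S \<subseteq> ?U \<union> - {?s}"
    using iff by auto
  ultimately have "?U \<inter> ?S = {} \<or> - {?s} \<inter> ?S = {}"
    by (rule connectedD)
  \<comment> \<open>This excludes the first alternative; the second says that every solution equals
    \<open>?s\<close>.\<close>
  moreover have "?s \<in> ?S" "?s \<in> ?U"
    using iff[of ?s] by simp_all
  ultimately show ?thesis
    by blast
qed

end
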